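(* Let $n\ge 1$ and let $(x_1,\dots,x_n)$ be an $n$-tuple of distinct points of $\mathbb{R}^2$. Then $(x_1,\dots,x_n)$ has the weighted discrete Pompeiu property with respect to the family of direct similarities of $\mathbb{R}^2$.
   Context: Let $\mathcal{G}$ be a family of bijections of a set $X$ onto itself. An $n$-tuple $(x_1,\dots,x_n)$ of points of $X$ has the weighted discrete Pompeiu property with respect to $\mathcal{G}$ if the following holds: whenever $\alpha_1,\dots,\alpha_n$ are complex numbers with $\sum_{i=1}^n\alpha_i\neq 0$ and $f\colon X\to\mathbb{C}$ is a function (no regularity assumed) such that $\sum_{j=1}^n\alpha_j f(\phi(x_j))=0$ for every $\phi\in\mathcal{G}$, then $f\equiv 0$. A direct similarity of $\mathbb{R}^2$ is a transformation that is a composition of translations, rotations and homothetic transformations; identifying $\mathbb{R}^2$ with $\mathbb{C}$, these are the maps $z\mapsto a+cz$ with $a\in\mathbb{C}$, $c\in\mathbb{C}\setminus\{0\}$. *)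

theory Defs
  imports "HOL-Analysis.Analysis"
begin

text \<open>The set \<open>X\<close> is the whole type \<open>'a\<close>. An \<open>n\<close>-tuple is a function on \<open>nat\<close> of which only
  the values at \<open>1, \<dots>, n\<close> matter; likewise for the weights. The family \<open>G\<close> is meant to consist
  of bijections (see \<open>bij_direct_similarity\<close> below); the definition itself does not depend on it.\<close>

definition weighted_discrete_Pompeiu :: "('a \<Rightarrow> 'a) set \<Rightarrow> nat \<Rightarrow> (nat \<Rightarrow> 'a) \<Rightarrow> bool" where
  "weighted_discrete_Pompeiu G n x \<longleftrightarrow>
     (\<forall>(\<alpha> :: nat \<Rightarrow> complex) (f :: 'a \<Rightarrow> complex).
        (\<Sum>j = 1..n. \<alpha> j) \<noteq> 0 \<longrightarrow>
        (\<forall>\<phi> \<in> G. (\<Sum>j = 1..n. \<alpha> j * f (\<phi> (x j))) = 0) \<longrightarrow>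
        (\<forall>y. f y = 0))"

text \<open>The plane \<open>\<real>\<^sup>2\<close> is identified with the complex numbers. Rotations and homotheties may have
  any centre; the ratio of a homothety is any nonzero real number.\<close>

definition translation :: "complex \<Rightarrow> complex \<Rightarrow> complex" where
  "translation a z = z + a"

definition rotation :: "complex \<Rightarrow> real \<Rightarrow> complex \<Rightarrow> complex" where
  "rotation p \<theta> z = p + cis \<theta> * (z - p)"

definition homothety :: "complex \<Rightarrow> real \<Rightarrow> complex \<Rightarrow> complex" where
  "homothety p r z = p + r *\<^sub>R (z - p)"

inductive_set direct_similarities :: "(complex \<Rightarrow> complex) set" where
  translation: "translation a \<in> direct_similarities"
| rotation: "rotation p \<theta> \<in> direct_similarities"
| homothety: "r \<noteq> 0 \<Longrightarrow> homothety p r \<in> direct_similarities"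
| comp: "\<phi> \<in> direct_similarities \<Longrightarrow> \<psi> \<in> direct_similarities \<Longrightarrow> \<phi> \<circ> \<psi> \<in> direct_similarities"

lemma direct_similarities_eq:
  "direct_similarities = {\<lambda>z. a + c * z | a c. c \<noteq> 0}"
proof (intro equalityI subsetI)
  fix \<phi> assume "\<phi> \<in> direct_similarities"
  then have "\<exists>a c. c \<noteq> 0 \<and> (\<forall>z. \<phi> z = a + c * z)"
  proof induction
    case (translation a)
    show ?case
      by (rule exI[of _ a], rule exI[of _ 1]) (simp add: translation_def)
  next
    case (rotation p \<theta>)
    show ?case
      by (rule exI[of _ "p - cis \<theta> * p"], rule exI[of _ "cis \<theta>"])
        (simp add: rotation_def algebra_simps)
  next
    case (homothety r p)
    then show ?case
      by (intro exI[of _ "p - of_real r * p"] exI[of _ "of_real r"])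
        (simp add: homothety_def scaleR_conv_of_real algebra_simps)
  next
    case (comp \<phi> \<psi>)
    then obtain a c b d where *: "c \<noteq> 0" "d \<noteq> 0"
      "\<And>z. \<phi> z = a + c * z" "\<And>z. \<psi> z = b + d * z"
      by metis
    show ?case
      by (rule exI[of _ "a + c * b"], rule exI[of _ "c * d"]) (simp add: * algebra_simps)
  qed
  then show "\<phi> \<in> {\<lambda>z. a + c * z | a c. c \<noteq> 0}" by blast
next
  fix \<phi> :: "complex \<Rightarrow> complex"
  assume "\<phi> \<in> {\<lambda>z. a + c * z | a c. c \<noteq> 0}"
  then obtain a c where c: "c \<noteq> 0" and \<phi>: "\<phi> = (\<lambda>z. a + c * z)" by blast
  have "a + c * z = z * (of_real (cmod c) * cis (Arg c)) + a" for z
    using rcis_cmod_Arg[of c] by (simp add: rcis_def)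
  then have "\<phi> = translation a \<circ> (homothety 0 (cmod c) \<circ> rotation 0 (Arg c))"
    by (simp add: \<phi> fun_eq_iff translation_def homothety_def rotation_def
        scaleR_conv_of_real ac_simps)
  then show "\<phi> \<in> direct_similarities"
    using c by (simp add: direct_similarities.intros)
qed

lemma bij_direct_similarity:
  assumes "\<phi> \<in> direct_similarities"
  shows "bij \<phi>"
proof -
  obtain a c where c: "c \<noteq> 0" and \<phi>: "\<phi> = (\<lambda>z. a + c * z)"
    using assms by (auto simp: direct_similarities_eq)
  show ?thesis
    by (rule bij_betw_byWitness[where f' = "\<lambda>w. (w - a) / c"]) (use c in \<open>auto simp: \<phi>\<close>)
qed

end

theory Submission
  imports Defs
begin

text \<open>
  Only the maps \<open>z \<mapsto> a + k z\<close> with \<open>k = 1, \<dots>, n\<close> are needed. Let \<open>T\<^sub>j\<close> be the shift operator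
  \<open>(T\<^sub>j f)(y) = f (y + x\<^sub>j)\<close> and let \<open>g\<^sub>k = \<Sum>\<^sub>j \<alpha>\<^sub>j T\<^sub>j\<^sup>k\<close>. The hypothesis on \<open>f\<close> gives
  \<open>g\<^sub>k f = 0\<close> for \<open>1 \<le> k \<le> n\<close>, while \<open>g\<^sub>0\<close> is multiplication by \<open>s = \<Sum>\<^sub>j \<alpha>\<^sub>j \<noteq> 0\<close>. The shifts
  commute and each \<open>T\<^sub>j\<close> is a root of the polynomial \<open>p(t) = \<Prod>\<^sub>i (t - T\<^sub>i)\<close>, so, as in Newton's
  identities for power sums,
  \<open>0 = \<Sum>\<^sub>j \<alpha>\<^sub>j p(T\<^sub>j) = \<Sum>\<^sub>k p\<^sub>k g\<^sub>k\<close>, where \<open>p\<^sub>k\<close> is the coefficient of \<open>t\<^sup>k\<close> in \<open>p\<close>. Applied to \<open>f\<close>,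
  every term except \<open>k = 0\<close> vanishes, and what remains is \<open>\<plusminus>s\<close> times the shift of \<open>f\<close> by
  \<open>x\<^sub>1 + \<dots> + x\<^sub>n\<close>. Since shifts are invertible, \<open>f = 0\<close>.

  The product \<open>p\<close> is expanded over the subsets \<open>S\<close> of the index set, which turns the identity into
  a double sum of values of \<open>f\<close>; the equation \<open>p(T\<^sub>j) = 0\<close> then becomes the cancellation of
  \<open>S\<close> against \<open>S \<union> {j}\<close>.
\<close>

text \<open>Adding or removing \<open>j\<close> pairs off the subsets of \<open>A\<close> and reverses the sign.\<close>

lemma alternating_sum_Pow_eq_0:
  fixes F :: "'b set \<Rightarrow> 'c :: comm_ring_1"
  assumes "finite A" and "j \<in> A"
    and F: "\<And>S. S \<subseteq> A - {j} \<Longrightarrow> F (insert j S) = F S"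
  shows "(\<Sum>S\<in>Pow A. (-1) ^ card S * F S) = 0"
proof -
  define B where "B = A - {j}"
  have B: "finite B" "j \<notin> B" "A = insert j B"
    using assms by (auto simp: B_def)
  have inj: "inj_on (insert j) (Pow B)"
    using \<open>j \<notin> B\<close> by (auto simp: inj_on_def)
  have "(\<Sum>S\<in>Pow A. (-1) ^ card S * F S)
      = (\<Sum>S\<in>Pow B. (-1) ^ card S * F S) + (\<Sum>S\<in>insert j ` Pow B. (-1) ^ card S * F S)"
    unfolding B(3) Pow_insert using B by (intro sum.union_disjoint) auto
  also have "(\<Sum>S\<in>insert j ` Pow B. (-1) ^ card S * F S)
      = (\<Sum>S\<in>Pow B. (-1) ^ card (insert j S) * F (insert j S))"
    by (simp add: sum.reindex[OF inj])
  also have "\<dots> = (\<Sum>S\<in>Pow B. - ((-1) ^ card S * F S))"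
  proof (rule sum.cong)
    fix S assume "S \<in> Pow B"
    then have "finite S" "j \<notin> S" "S \<subseteq> A - {j}"
      using B(1,2) by (auto simp: B_def intro: finite_subset)
    then show "(-1) ^ card (insert j S) * F (insert j S) = - ((-1) ^ card S * F S)"
      by (simp add: F)
  qed simp
  finally show ?thesis
    by (simp add: sum_negf)
qed

text \<open>The bound \<open>card A\<close> on the scales is the degree of \<open>p\<close>: the relation \<open>\<Sum>\<^sub>k p\<^sub>k g\<^sub>k = 0\<close> involves
  no power sums \<open>g\<^sub>k\<close> of the shifts beyond it. Its constant coefficient is, up to sign, the product of
  all the shifts, so the relation is evaluated at the point \<open>z\<close> that this product moves to \<open>y\<close>.\<close>

lemma eq_0_if_weighted_sums_over_dilates_eq_0:
  fixes x :: "'b \<Rightarrow> 'a :: real_vector" and f :: "'a \<Rightarrow> 'c :: idom"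
  assumes "finite A" and "sum \<alpha> A \<noteq> 0"
    and dilates: "\<And>a k. 1 \<le> k \<Longrightarrow> k \<le> card A \<Longrightarrow>
      (\<Sum>j\<in>A. \<alpha> j * f (a + real k *\<^sub>R x j)) = 0"
  shows "f y = 0"
proof -
  define z where "z = y - sum x A"
  \<comment> \<open>In the expansion of \<open>p(T\<^sub>j) = \<Prod>\<^sub>i (T\<^sub>j - T\<^sub>i)\<close>, the set \<open>S\<close> records the factors from which
    \<open>- T\<^sub>i\<close> is taken; \<open>v j S\<close> is the value at \<open>z\<close> of the resulting shift of \<open>f\<close>, without its sign.\<close>
  define v where "v j S = f (z + sum x S + real (card A - card S) *\<^sub>R x j)" for j S
  have root: "(\<Sum>S\<in>Pow A. (-1) ^ card S * v j S) = 0" if "j \<in> A" for j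
  proof (rule alternating_sum_Pow_eq_0)
    fix S assume S: "S \<subseteq> A - {j}"
    then have fin: "finite S" and "j \<notin> S" and "insert j S \<subseteq> A"
      using \<open>finite A\<close> \<open>j \<in> A\<close> by (auto intro: finite_subset)
    then have "card (insert j S) \<le> card A"
      using \<open>finite A\<close> by (intro card_mono)
    with fin \<open>j \<notin> S\<close> have "card A - card S = Suc (card A - card (insert j S))"
      by simp
    then show "v j (insert j S) = v j S"
      using fin \<open>j \<notin> S\<close> by (simp add: v_def algebra_simps)
  qed fact+
  have proper: "(\<Sum>j\<in>A. \<alpha> j * v j S) = 0" if "S \<in> Pow A - {A}" for S
  proof -
    have "card S < card A"
      using that \<open>finite A\<close> by (intro psubset_card_mono) auto
    then show ?thesis
      unfolding v_def by (intro dilates) auto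
  qed
  have "0 = (\<Sum>j\<in>A. \<alpha> j * (\<Sum>S\<in>Pow A. (-1) ^ card S * v j S))"
    by (simp add: root)
  also have "\<dots> = (\<Sum>S\<in>Pow A. (-1) ^ card S * (\<Sum>j\<in>A. \<alpha> j * v j S))"
    unfolding sum_distrib_left by (subst sum.swap) (simp add: mult.left_commute)
  also have "\<dots> = (-1) ^ card A * (\<Sum>j\<in>A. \<alpha> j * v j A)"
    using \<open>finite A\<close> by (subst sum.remove[of _ A]) (simp_all add: proper)
  also have "\<dots> = (-1) ^ card A * (sum \<alpha> A * f y)"
    by (simp add: v_def z_def sum_distrib_right)
  finally show ?thesis
    using \<open>sum \<alpha> A \<noteq> 0\<close> by simp
qed

theorem theorem3p3:
  fixes n :: nat and x :: "nat \<Rightarrow> complex"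
  assumes "n \<ge> 1"
    and "inj_on x {1..n}"
  shows "weighted_discrete_Pompeiu direct_similarities n x"
  unfolding weighted_discrete_Pompeiu_def
proof (intro allI impI)
  fix \<alpha> :: "nat \<Rightarrow> complex" and f :: "complex \<Rightarrow> complex" and y
  assume s: "(\<Sum>j = 1..n. \<alpha> j) \<noteq> 0"
    and f: "\<forall>\<phi>\<in>direct_similarities. (\<Sum>j = 1..n. \<alpha> j * f (\<phi> (x j))) = 0"
  show "f y = 0"
  proof (rule eq_0_if_weighted_sums_over_dilates_eq_0[of "{1..n}" \<alpha> f x])
    fix a and k :: nat assume "1 \<le> k"
    then have "(\<lambda>w. a + of_nat k * w) \<in> direct_similarities"
      unfolding direct_similarities_eq by (intro CollectI exI[of _ a] exI[of _ "of_nat k"]) simp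
    with f show "(\<Sum>j = 1..n. \<alpha> j * f (a + real k *\<^sub>R x j)) = 0"
      by (auto simp: scaleR_conv_of_real)
  qed (use s in auto)
qed

end
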